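(* For every integer $d \ge 2$ there exists a compact set $K \subseteq [0,1]^d$ such that for every hyperplane $H \subseteq \mathbb{R}^d$ the orthogonal projection of $K$ onto $H$ has non-empty interior (relative to $H$), but $K+K$ is nowhere dense in $\mathbb{R}^d$.
   Context: A hyperplane in $\mathbb{R}^d$ is a $(d-1)$-dimensional affine subspace. $K+K=\{x+y : x,y\in K\}$ is the Minkowski sum. *)

theory Defs
  imports "HOL-Analysis.Analysis" "HOL-Library.Set_Algebras"
begin

definition is_hyperplane :: "'a::euclidean_space set \<Rightarrow> bool" where
  "is_hyperplane H \<longleftrightarrow> affine H \<and> aff_dim H = int DIM('a) - 1"

definition orthogonal_projection :: "'a::euclidean_space set \<Rightarrow> 'a \<Rightarrow> 'a" where
  "orthogonal_projection H x = (THE y. y \<in> H \<and> (\<forall>z\<in>H. orthogonal (x - y) (z - y)))"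

definition nowhere_dense :: "'a::topological_space set \<Rightarrow> bool" where
  "nowhere_dense S \<longleftrightarrow> interior (closure S) = {}"

text \<open>The definite description above is well-defined on every nonempty affine set.\<close>

lemma orthogonal_projection_ex1:
  fixes H :: "'a::euclidean_space set"
  assumes "affine H" "H \<noteq> {}"
  shows "\<exists>!y. y \<in> H \<and> (\<forall>z\<in>H. orthogonal (x - y) (z - y))"
proof (rule ex_ex1I)
  obtain a where a: "a \<in> H" using assms(2) by blast
  define V where "V = (\<lambda>z. - a + z) ` H"
  have V: "subspace V"
    unfolding V_def using affine_diffs_subspace[OF assms(1) a] by simp
  obtain y w where y: "y \<in> span V" and w: "\<And>v. v \<in> span V \<Longrightarrow> orthogonal w v"
    and eq: "x - a = y + w"
    using orthogonal_subspace_decomp_exists[of V "x - a"] by metis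
  have "y \<in> V" using y V span_eq_iff by blast
  then have yH: "a + y \<in> H" by (auto simp: V_def)
  have "orthogonal (x - (a + y)) (z - (a + y))" if z: "z \<in> H" for z
  proof -
    have "z - a \<in> V" using z by (auto simp: V_def)
    then have "(z - a) - y \<in> span V" using y by (meson span_base span_diff)
    moreover have "(z - a) - y = z - (a + y)" "x - (a + y) = w"
      using eq by (simp_all add: algebra_simps)
    ultimately show ?thesis using w by metis
  qed
  then show "\<exists>y. y \<in> H \<and> (\<forall>z\<in>H. orthogonal (x - y) (z - y))" using yH by blast
next
  fix y y'
  assume y: "y \<in> H \<and> (\<forall>z\<in>H. orthogonal (x - y) (z - y))"
    and y': "y' \<in> H \<and> (\<forall>z\<in>H. orthogonal (x - y') (z - y'))"
  have "(x - y) \<bullet> (y' - y) = 0" "(x - y') \<bullet> (y - y') = 0"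
    using y y' by (auto simp: orthogonal_def)
  then have "(y - y') \<bullet> (y - y') = 0"
    by (simp add: inner_diff_left inner_diff_right inner_commute)
  then show "y = y'" by simp
qed

end

theory Submission
  imports Defs
begin

text \<open>
  A set that meets every line meeting a fixed ball projects onto a set with nonempty relative
  interior in every hyperplane. Such a blocking set \<open>K\<close> is the intersection of nested compact sets
  whose interiors are blocking; a dense sequence of points \<open>q\<close> is removed from \<open>K + K\<close> one at a time.
  For a single \<open>q\<close>, finitely many small spheres inside the current interior block all the lines, by
  compactness. A line meets the spheres \<open>A\<close> already chosen only finitely often, so there is always
  room on it to centre the next sphere off \<open>q - A\<close>; the result, slightly thickened, still has \<open>q\<close>
  outside its sumset.
\<close>

text \<open>A pair \<open>(a, v)\<close> stands for the line through \<open>a\<close> in direction \<open>v\<close>.\<close>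

definition blocks :: "'a::real_vector set \<Rightarrow> ('a \<times> 'a) set \<Rightarrow> bool" where
  "blocks A Z \<longleftrightarrow> (\<forall>(a, v)\<in>Z. \<exists>s. a + s *\<^sub>R v \<in> A)"

text \<open>The property survives the reflection sending \<open>x\<close> to \<open>q - x\<close>,
  so \<open>q - A\<close> never fills an open piece of a line. Spheres have it, solid balls of
  positive radius do not.\<close>

definition meets_lines_finitely :: "'a::real_vector set \<Rightarrow> bool" where
  "meets_lines_finitely A \<longleftrightarrow> (\<forall>a v. v \<noteq> 0 \<longrightarrow> finite {s. a + s *\<^sub>R v \<in> A})"

lemma blocks_mono: "blocks A Z \<Longrightarrow> A \<subseteq> B \<Longrightarrow> blocks B Z"
  unfolding blocks_def by fast

lemma blocksD: "blocks A Z \<Longrightarrow> (a, v) \<in> Z \<Longrightarrow> \<exists>s. a + s *\<^sub>R v \<in> A"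
  unfolding blocks_def by fast

section \<open>Lines against finite sets, spheres and balls\<close>

lemma meets_lines_finitely_Un:
  assumes "meets_lines_finitely A" "meets_lines_finitely B"
  shows "meets_lines_finitely (A \<union> B)"
  using assms unfolding meets_lines_finitely_def by (simp add: Collect_disj_eq)

lemma meets_lines_finitely_UN:
  assumes "finite I" "\<And>i. i \<in> I \<Longrightarrow> meets_lines_finitely (A i)"
  shows "meets_lines_finitely (\<Union>i\<in>I. A i)"
  using assms
proof (induction I rule: finite_induct)
  case empty
  then show ?case by (simp add: meets_lines_finitely_def)
next
  case (insert i I)
  then show ?case by (simp add: meets_lines_finitely_Un)
qed

lemma meets_lines_finitely_sphere:
  fixes x :: "'a::real_inner"
  shows "meets_lines_finitely (sphere x r)"
  unfolding meets_lines_finitely_def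
proof (intro allI impI)
  fix a v :: 'a
  assume v: "v \<noteq> 0"
  \<comment> \<open>\<open>?p\<close> is the squared norm of \<open>a - x + s v\<close> minus the
    squared radius, as a quadratic in \<open>s\<close>; its leading coefficient
    \<open>v \<bullet> v\<close> is nonzero.\<close>
  let ?p = "[:(a - x) \<bullet> (a - x) - r\<^sup>2, 2 * ((a - x) \<bullet> v), v \<bullet> v:]"
  have "poly ?p s = 0" if "a + s *\<^sub>R v \<in> sphere x r" for s
  proof -
    have "norm ((a - x) + s *\<^sub>R v) = r"
      using that by (simp add: dist_norm norm_minus_commute algebra_simps)
    then have "((a - x) + s *\<^sub>R v) \<bullet> ((a - x) + s *\<^sub>R v) = r\<^sup>2"
      by (metis power2_norm_eq_inner)
    then show ?thesis
      by (simp add: inner_add_left inner_add_right inner_commute algebra_simps)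
  qed
  then have "{s. a + s *\<^sub>R v \<in> sphere x r} \<subseteq> {s. poly ?p s = 0}" by blast
  moreover have "finite {s. poly ?p s = 0}"
    using v by (intro poly_roots_finite) simp
  ultimately show "finite {s. a + s *\<^sub>R v \<in> sphere x r}" by (rule finite_subset)
qed

text \<open>The parameters that land in \<open>V\<close> form a nonempty open set of reals, hence an
  infinite one.\<close>

lemma line_in_open_avoids_finite:
  fixes a v :: "'a::real_normed_vector"
  assumes "open V" "a + t *\<^sub>R v \<in> V" "finite F"
  shows "\<exists>s. s \<notin> F \<and> a + s *\<^sub>R v \<in> V"
proof -
  have "open ((\<lambda>s. a + s *\<^sub>R v) -` V)"
    by (intro open_vimage assms continuous_intros)
  moreover have "t \<in> (\<lambda>s. a + s *\<^sub>R v) -` V" using assms by simp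
  ultimately have "infinite ((\<lambda>s. a + s *\<^sub>R v) -` V)"
    using finite_imp_not_open by blast
  then have "\<not> (\<lambda>s. a + s *\<^sub>R v) -` V \<subseteq> F"
    using assms(3) finite_subset by blast
  then show ?thesis by blast
qed

text \<open>A line is connected and unbounded, so once inside the ball it has to cross the
  boundary.\<close>

lemma line_through_ball_meets_sphere:
  fixes a v :: "'a::euclidean_space"
  assumes "v \<noteq> 0" "a + s *\<^sub>R v \<in> ball x r"
  shows "\<exists>t. a + t *\<^sub>R v \<in> sphere x r"
proof -
  let ?M = "range (\<lambda>t. a + t *\<^sub>R v)"
  have conn: "connected ?M"
    by (intro connected_continuous_image continuous_intros) simp
  have "\<exists>t. \<not> dist x (a + t *\<^sub>R v) < r"
  proof
    \<comment> \<open>The parameter is so large that, by the triangle inequality, the point lies at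
      distance at least \<open>\<bar>r\<bar>\<close> from \<open>x\<close>.\<close>
    let ?t = "(\<bar>r\<bar> + norm (a - x)) / norm v"
    have "\<bar>r\<bar> + norm (a - x) = norm (?t *\<^sub>R v)" using assms(1) by simp
    also have "\<dots> \<le> norm (a + ?t *\<^sub>R v - x) + norm (a - x)"
      using norm_triangle_ineq4[of "a + ?t *\<^sub>R v - x" "a - x"] by (simp add: algebra_simps)
    finally show "\<not> dist x (a + ?t *\<^sub>R v) < r" by (simp add: dist_norm norm_minus_commute)
  qed
  then have "?M - ball x r \<noteq> {}" by fastforce
  moreover have "?M \<inter> ball x r \<noteq> {}" using assms(2) by blast
  ultimately have "?M \<inter> frontier (ball x r) \<noteq> {}"
    using connected_Int_frontier[OF conn] by blast
  moreover have "r > 0" using assms(2) zero_le_dist[of x "a + s *\<^sub>R v"] by (simp del: zero_le_dist)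
  ultimately show ?thesis by (auto simp: frontier_ball)
qed

section \<open>Blocking sets whose sumset misses one point\<close>

lemma compact_set_plus:
  fixes A B :: "'a::real_normed_vector set"
  assumes "compact A" "compact B"
  shows "compact (A + B)"
proof -
  have "A + B = {x + y |x y. x \<in> A \<and> y \<in> B}" by (auto simp: set_plus_def)
  then show ?thesis using compact_sums[OF assms] by simp
qed

text \<open>New points are taken only from \<open>W\<close>, the part of \<open>V\<close> off
  \<open>q - A\<close>: a point of \<open>A\<close> plus a point of \<open>W\<close> is never
  \<open>q\<close>, and \<open>W + W\<close> misses \<open>q\<close> because \<open>V + V\<close>
  does. Compactness of \<open>Z\<close> reduces the new points to finitely many spheres.\<close>

lemma block_locally:
  fixes Z :: "('a::euclidean_space \<times> 'a) set"
  assumes Z: "compact Z" "0 \<notin> snd ` Z" "blocks V Z"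
    and V: "open V" "q \<notin> V + V"
    and A: "compact A" "meets_lines_finitely A" "q \<notin> A + A"
  shows "\<exists>B. compact B \<and> meets_lines_finitely B \<and> A \<subseteq> B \<and> B \<subseteq> A \<union> V \<and>
           q \<notin> B + B \<and> blocks B Z"
proof -
  define W where "W = V - (\<lambda>x. q - x) ` A"
  have "compact ((\<lambda>x. q - x) ` A)"
    by (intro compact_continuous_image A continuous_intros)
  then have W: "open W"
    unfolding W_def using V(1) compact_imp_closed by blast
  have "\<exists>s x r. fst z + s *\<^sub>R snd z \<in> ball x r \<and> cball x r \<subseteq> W" if z: "z \<in> Z" for z
  proof -
    obtain a v where av: "z = (a, v)" by fastforce
    have v: "v \<noteq> 0" using Z(2) z av by force
    obtain t where t: "a + t *\<^sub>R v \<in> V" using blocksD[OF Z(3)] z av by blast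
    \<comment> \<open>Reflection turns the hits of the line on \<open>q - A\<close> into hits on
      \<open>A\<close> of the line through \<open>q - a\<close> in direction
      \<open>- v\<close>.\<close>
    have "finite {s. (q - a) + s *\<^sub>R (- v) \<in> A}"
      using A(2) v unfolding meets_lines_finitely_def by (metis neg_equal_0_iff_equal)
    moreover have "{s. a + s *\<^sub>R v \<in> (\<lambda>x. q - x) ` A} \<subseteq> {s. (q - a) + s *\<^sub>R (- v) \<in> A}"
    proof clarify
      fix s x assume "a + s *\<^sub>R v = q - x" "x \<in> A"
      then have "(q - a) + s *\<^sub>R (- v) = x" by (simp add: algebra_simps)
      then show "(q - a) + s *\<^sub>R (- v) \<in> A" using \<open>x \<in> A\<close> by simp
    qed
    ultimately have "finite {s. a + s *\<^sub>R v \<in> (\<lambda>x. q - x) ` A}" by (rule finite_subset[rotated])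
    then obtain s where "a + s *\<^sub>R v \<in> W"
      using line_in_open_avoids_finite[OF V(1) t] unfolding W_def by blast
    moreover from this obtain r where "r > 0" "cball (a + s *\<^sub>R v) r \<subseteq> W"
      using W open_contains_cball by blast
    ultimately show ?thesis
      by (intro exI[of _ s] exI[of _ "a + s *\<^sub>R v"] exI[of _ r]) (simp add: av)
  qed
  then obtain s x r where sxr: "\<And>z. z \<in> Z \<Longrightarrow> fst z + s z *\<^sub>R snd z \<in> ball (x z) (r z)"
    "\<And>z. z \<in> Z \<Longrightarrow> cball (x z) (r z) \<subseteq> W" by metis
  \<comment> \<open>Lines close to \<open>z\<close> still enter the ball of \<open>z\<close> at the
    same parameter \<open>s z\<close>, which makes \<open>N z\<close> open.\<close>
  define N where "N z = (\<lambda>y. fst y + s z *\<^sub>R snd y) -` ball (x z) (r z)" for z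
  have "open (N z)" for z
    unfolding N_def by (intro open_vimage continuous_intros open_ball)
  moreover have "Z \<subseteq> (\<Union>z\<in>Z. N z)" using sxr(1) unfolding N_def by blast
  ultimately obtain I where I: "I \<subseteq> Z" "finite I" "Z \<subseteq> (\<Union>z\<in>I. N z)"
    using compactE_image[OF Z(1)] by metis
  define S where "S = (\<Union>z\<in>I. sphere (x z) (r z))"
  have SW: "S \<subseteq> W"
    unfolding S_def using sxr(2) I(1) sphere_cball by blast
  have "compact (A \<union> S)"
    unfolding S_def using A(1) I(2) by (intro compact_Un compact_UN) auto
  moreover have "meets_lines_finitely (A \<union> S)"
    unfolding S_def
    by (intro meets_lines_finitely_Un meets_lines_finitely_UN A I meets_lines_finitely_sphere)
  moreover have "q \<notin> (A \<union> S) + (A \<union> S)"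
  proof -
    have AS: "u + w \<noteq> q" if "u \<in> A" "w \<in> S" for u w
      using that SW unfolding W_def by (auto simp: image_iff algebra_simps)
    have "q \<notin> S + S" using SW V(2) set_plus_mono2[of S V S V] unfolding W_def by blast
    moreover have "q \<notin> A + S" "q \<notin> S + A"
      using AS by (auto elim!: set_plus_elim simp: add.commute)
    ultimately show ?thesis
      using A(3) by (auto elim!: set_plus_elim dest: set_plus_intro)
  qed
  moreover have "blocks (A \<union> S) Z"
    unfolding blocks_def
  proof (clarify)
    fix a v assume av: "(a, v) \<in> Z"
    then obtain z where z: "z \<in> I" "(a, v) \<in> N z" using I(3) by blast
    moreover have "v \<noteq> 0" using Z(2) av by force
    ultimately obtain t where "a + t *\<^sub>R v \<in> sphere (x z) (r z)"
      using line_through_ball_meets_sphere unfolding N_def by fastforce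
    then show "\<exists>t. a + t *\<^sub>R v \<in> A \<union> S" unfolding S_def using z(1) by blast
  qed
  moreover have "A \<union> S \<subseteq> A \<union> V" using SW unfolding W_def by blast
  ultimately show ?thesis by (intro exI[of _ "A \<union> S"]) auto
qed

text \<open>\<open>block_locally\<close> cannot be applied to \<open>U\<close> itself, since
  \<open>q\<close> may lie in \<open>U + U\<close>. Instead \<open>Z\<close> is cut into finitely
  many compact pieces, each blocked by a ball whose sumset misses \<open>q\<close>, and the pieces
  are treated one after another.\<close>

lemma block_inside_open:
  fixes Z :: "('a::euclidean_space \<times> 'a) set"
  assumes Z: "compact Z" "0 \<notin> snd ` Z" "blocks U Z"
    and U: "open U"
  shows "\<exists>B. compact B \<and> B \<subseteq> U \<and> q \<notin> B + B \<and> blocks B Z"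
proof -
  define m where "m = (1/2) *\<^sub>R q"
  \<comment> \<open>a ball \<open>V\<close> avoiding \<open>m\<close> satisfies \<open>q \<notin> V + V\<close> by convexity\<close>
  have "\<exists>t p r. fst z + t *\<^sub>R snd z \<in> ball p r \<and> ball p (2 * r) \<subseteq> U - {m}" if z: "z \<in> Z" for z
  proof -
    obtain a v where av: "z = (a, v)" by fastforce
    have v: "v \<noteq> 0" using Z(2) z av by force
    obtain t where t: "a + t *\<^sub>R v \<in> U" using blocksD[OF Z(3)] z av by blast
    have "inj (\<lambda>s. a + s *\<^sub>R v)" using v by (simp add: inj_def)
    then have "finite {s. a + s *\<^sub>R v = m}"
      using finite_vimageI[of "{m}" "\<lambda>s. a + s *\<^sub>R v"] by (simp add: vimage_def)
    then obtain s where "a + s *\<^sub>R v \<in> U - {m}"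
      using line_in_open_avoids_finite[OF U t] by blast
    moreover from this obtain r where "r > 0" "ball (a + s *\<^sub>R v) r \<subseteq> U - {m}"
      using U open_contains_ball[of "U - {m}"] by blast
    ultimately show ?thesis
      by (intro exI[of _ s] exI[of _ "a + s *\<^sub>R v"] exI[of _ "r / 2"]) (simp add: av)
  qed
  then obtain t p r where tpr: "\<And>z. z \<in> Z \<Longrightarrow> fst z + t z *\<^sub>R snd z \<in> ball (p z) (r z)"
    "\<And>z. z \<in> Z \<Longrightarrow> ball (p z) (2 * r z) \<subseteq> U - {m}" by metis
  define f where "f z = (\<lambda>y::'a \<times> 'a. fst y + t z *\<^sub>R snd y)" for z
  have f: "continuous_on X (f z)" for X z
    unfolding f_def by (intro continuous_intros)
  define N where "N z = f z -` ball (p z) (r z)" for z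
  have "open (N z)" for z
    unfolding N_def by (intro open_vimage f open_ball)
  moreover have "Z \<subseteq> (\<Union>z\<in>Z. N z)" using tpr(1) unfolding f_def N_def by blast
  ultimately obtain I where I: "I \<subseteq> Z" "finite I" "Z \<subseteq> (\<Union>z\<in>I. N z)"
    using compactE_image[OF Z(1)] by metis
  \<comment> \<open>Closed balls make the pieces compact, as \<open>block_locally\<close> demands;
    doubling the radius leaves an open ball around each closed one to serve as
    \<open>V\<close>.\<close>
  define Y where "Y z = Z \<inter> f z -` cball (p z) (r z)" for z
  have Y: "compact (Y z)" for z
    unfolding Y_def by (intro compact_Int_closed Z closed_vimage f closed_cball)
  have Y0: "0 \<notin> snd ` Y z" for z
    using Z(2) unfolding Y_def by blast
  \<comment> \<open>\<open>B\<close> only grows along the induction, so the pieces already blocked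
    stay blocked.\<close>
  have "\<exists>B. compact B \<and> meets_lines_finitely B \<and> B \<subseteq> U \<and> q \<notin> B + B \<and>
          (\<forall>z\<in>J. blocks B (Y z))" if "finite J" "J \<subseteq> Z" for J
    using that
  proof (induction J rule: finite_induct)
    case empty
    show ?case by (intro exI[of _ "{}"]) (simp add: meets_lines_finitely_def)
  next
    case (insert z J)
    then obtain A where A: "compact A" "meets_lines_finitely A" "A \<subseteq> U"
      "q \<notin> A + A" "\<forall>z\<in>J. blocks A (Y z)" by auto
    let ?V = "ball (p z) (2 * r z)"
    have V: "?V \<subseteq> U - {m}" using tpr(2) insert.prems by blast
    have "r z > 0" using tpr(1)[of z] insert.prems
      by (metis ball_eq_empty empty_iff insert_subset not_le)
    then have "cball (p z) (r z) \<subseteq> ?V" by (simp add: cball_subset_ball_iff)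
    then have bV: "blocks ?V (Y z)"
      unfolding blocks_def Y_def f_def by fastforce
    have sV: "q \<notin> ?V + ?V"
    proof
      assume "q \<in> ?V + ?V"
      then obtain x y where xy: "q = x + y" "x \<in> ?V" "y \<in> ?V" by (rule set_plus_elim)
      then have "m = (1/2) *\<^sub>R x + (1/2) *\<^sub>R y" unfolding m_def by (simp add: scaleR_add_right)
      also have "\<dots> \<in> ?V" using xy(2,3) by (intro convexD[OF convex_ball]) auto
      finally show False using V by blast
    qed
    obtain B where B: "compact B" "meets_lines_finitely B" "A \<subseteq> B" "B \<subseteq> A \<union> ?V"
      "q \<notin> B + B" "blocks B (Y z)"
      using block_locally[OF Y Y0 bV open_ball sV A(1,2,4)] by metis
    have "\<forall>z\<in>insert z J. blocks B (Y z)" using B(3,6) A(5) blocks_mono by blast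
    moreover have "B \<subseteq> U" using B(4) A(3) V by blast
    ultimately show ?case using B by blast
  qed
  from this[OF I(2,1)] obtain B where B: "compact B" "B \<subseteq> U" "q \<notin> B + B"
    "\<forall>z\<in>I. blocks B (Y z)" by blast
  have "blocks B Z"
    unfolding blocks_def
  proof clarify
    fix a v assume av: "(a, v) \<in> Z"
    then obtain z where z: "z \<in> I" "(a, v) \<in> N z" using I(3) by blast
    then have "(a, v) \<in> Y z" using av ball_subset_cball unfolding Y_def N_def by blast
    then show "\<exists>s. a + s *\<^sub>R v \<in> B" using B(4) z(1) blocksD by blast
  qed
  then show ?thesis using B by blast
qed

section \<open>Nested bodies and their intersection\<close>

text \<open>A compact blocking set \<open>B\<close> inside the interior of \<open>C\<close> has a
  closed sumset, so \<open>q\<close> is at positive distance from \<open>B + B\<close>. A small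
  uniform thickening of \<open>B\<close> keeps \<open>q\<close> out and has \<open>B\<close> in its
  interior.\<close>

lemma shrink_blocking_body:
  fixes Z :: "('a::euclidean_space \<times> 'a) set"
  assumes Z: "compact Z" "0 \<notin> snd ` Z" and C: "blocks (interior C) Z"
  shows "\<exists>D. compact D \<and> D \<subseteq> C \<and> blocks (interior D) Z \<and> q \<notin> D + D"
proof -
  obtain B where B: "compact B" "B \<subseteq> interior C" "q \<notin> B + B" "blocks B Z"
    using block_inside_open[OF Z C open_interior] by metis
  obtain e where e: "e > 0" "(\<Union>x\<in>B. ball x e) \<subseteq> interior C"
    using compact_subset_open_imp_ball_epsilon_subset[OF B(1) open_interior B(2)] by blast
  have "closed (B + B)" using B(1) by (intro compact_imp_closed compact_set_plus)
  then obtain d where d: "d > 0" "\<And>x y. x \<in> B \<Longrightarrow> y \<in> B \<Longrightarrow> d \<le> dist q (x + y)"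
    using separate_point_closed[of "B + B" q] B(3) set_plus_intro by metis
  \<comment> \<open>The bound \<open>e / 2\<close> keeps the thickening inside \<open>C\<close>;
    \<open>d / 3\<close> is used because errors from two summands add up to at most
    \<open>2 * k\<close>, which must stay below \<open>d\<close>.\<close>
  define k where "k = min (e / 2) (d / 3)"
  have k: "k > 0" "k < e" "2 * k < d" using e(1) d(1) unfolding k_def by auto
  define D where "D = B + cball 0 k"
  have "compact D" unfolding D_def by (intro compact_set_plus B compact_cball)
  moreover have "D \<subseteq> C"
  proof
    fix w assume "w \<in> D"
    then obtain x y where "w = x + y" "x \<in> B" "norm y \<le> k"
      unfolding D_def by (auto elim!: set_plus_elim)
    then have "w \<in> ball x e" "x \<in> B" using k by (auto simp: dist_norm)
    then show "w \<in> C" using e(2) interior_subset by blast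
  qed
  moreover have "B \<subseteq> interior D"
  proof
    fix x assume x: "x \<in> B"
    have "ball x k \<subseteq> D"
    proof
      fix w assume "w \<in> ball x k"
      then have "w - x \<in> cball 0 k" by (auto simp: dist_norm norm_minus_commute)
      from set_plus_intro[OF x this] show "w \<in> D" unfolding D_def by simp
    qed
    then show "x \<in> interior D" using k(1) by (meson centre_in_ball interior_maximal open_ball subsetD)
  qed
  then have "blocks (interior D) Z" using B(4) blocks_mono by blast
  moreover have "q \<notin> D + D"
  proof
    assume "q \<in> D + D"
    then obtain x y x' y' where q: "q = (x + y) + (x' + y')" "x \<in> B" "x' \<in> B" "norm y \<le> k" "norm y' \<le> k"
      unfolding D_def by (auto elim!: set_plus_elim)
    then have "dist q (x + x') = norm (y + y')" by (simp add: dist_norm algebra_simps)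
    also have "\<dots> \<le> 2 * k" using norm_triangle_ineq[of y y'] q by linarith
    finally show False using d(2)[OF q(2,3)] k(3) by linarith
  qed
  ultimately show ?thesis by blast
qed

lemma ex_blocking_set_nowhere_dense_sumset:
  fixes Z :: "('a::euclidean_space \<times> 'a) set"
  assumes Z: "compact Z" "0 \<notin> snd ` Z"
    and C: "compact C" "blocks (interior C) Z"
  shows "\<exists>K. compact K \<and> K \<subseteq> C \<and> blocks K Z \<and> nowhere_dense (K + K)"
proof -
  obtain Q :: "'a set" where Q: "countable Q" "\<And>X. open X \<Longrightarrow> X \<noteq> {} \<Longrightarrow> \<exists>d\<in>Q. d \<in> X"
    by (rule countable_dense_setE) blast
  have "Q \<noteq> {}" using Q(2)[of UNIV] by auto
  define q where "q = from_nat_into Q"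
  have rq: "range q = Q" unfolding q_def using Q(1) \<open>Q \<noteq> {}\<close> by (simp add: range_from_nat_into)
  \<comment> \<open>The invariant asks that the interior of each set blocks, not just the set: this
    is what permits the next shrinking.\<close>
  have "\<exists>F. \<forall>n. (compact (F n) \<and> F n \<subseteq> C \<and> blocks (interior (F n)) Z) \<and>
          F (Suc n) \<subseteq> F n \<and> q n \<notin> F (Suc n) + F (Suc n)"
  proof (rule dependent_nat_choice)
    show "\<exists>x. compact x \<and> x \<subseteq> C \<and> blocks (interior x) Z" using C by blast
  next
    fix x n assume "compact x \<and> x \<subseteq> C \<and> blocks (interior x) Z"
    then show "\<exists>y. (compact y \<and> y \<subseteq> C \<and> blocks (interior y) Z) \<and> y \<subseteq> x \<and> q n \<notin> y + y"
      using shrink_blocking_body[OF Z(1,2), where C = x and q = "q n"] by (meson order_trans)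
  qed
  then obtain F where F: "\<And>n. compact (F n)" "\<And>n. F n \<subseteq> C" "\<And>n. blocks (interior (F n)) Z"
    "\<And>n. F (Suc n) \<subseteq> F n" "\<And>n. q n \<notin> F (Suc n) + F (Suc n)" by blast
  have dec: "F n \<subseteq> F m" if "m \<le> n" for m n using lift_Suc_antimono_le[of F, OF F(4) that] .
  define K where "K = \<Inter>(range F)"
  have K: "compact K" unfolding K_def using F(1) by (intro compact_Inter) auto
  have "blocks K Z"
    unfolding blocks_def
  proof clarify
    fix a v assume av: "(a, v) \<in> Z"
    \<comment> \<open>The traces of the \<open>F n\<close> on one line are nested nonempty compact
      sets, so they share a point and blocking passes to the intersection.\<close>
    define T where "T n = F n \<inter> range (\<lambda>s. a + s *\<^sub>R v)" for n
    have line: "range (\<lambda>s. a + s *\<^sub>R v) = (\<lambda>x. a + x) ` span {v}"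
      by (auto simp: span_singleton)
    have "closed (range (\<lambda>s. a + s *\<^sub>R v))"
      unfolding line by (intro closed_translation closed_span)
    then have "compact (T n)" for n
      unfolding T_def using F(1) by (rule compact_Int_closed[rotated])
    moreover have "T n \<noteq> {}" for n
      unfolding T_def using blocksD[OF F(3) av] interior_subset by blast
    moreover have "T n \<subseteq> T m" if "m \<le> n" for m n
      using dec[OF that] unfolding T_def by blast
    ultimately have "\<Inter>(range T) \<noteq> {}" by (rule compact_nest)
    then show "\<exists>s. a + s *\<^sub>R v \<in> K" unfolding T_def K_def by blast
  qed
  moreover have "nowhere_dense (K + K)"
  proof -
    \<comment> \<open>\<open>K + K\<close> is its own closure and misses the dense set
      \<open>Q\<close>, so its interior is empty.\<close>
    have "closed (K + K)" using K by (intro compact_imp_closed compact_set_plus)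
    moreover have "q n \<notin> K + K" for n
    proof -
      have "K \<subseteq> F (Suc n)" unfolding K_def by blast
      then show ?thesis using F(5)[of n] set_plus_mono2 by blast
    qed
    then have "Q \<inter> interior (K + K) = {}" using rq interior_subset by blast
    then have "interior (K + K) = {}" using Q(2)[OF open_interior] by blast
    ultimately show ?thesis unfolding nowhere_dense_def by simp
  qed
  moreover have "K \<subseteq> C" unfolding K_def using F(2) by blast
  ultimately show ?thesis using K by blast
qed

section \<open>From blocked lines to projections\<close>

lemma orthogonal_projection_hyperplane:
  fixes u :: "'a::euclidean_space"
  assumes "H = {x. u \<bullet> x = b}" "y \<in> H"
  shows "orthogonal_projection H (y + s *\<^sub>R u) = y"
proof -
  have "affine H" "H \<noteq> {}" using assms affine_hyperplane by auto
  note ex1 = orthogonal_projection_ex1[OF this, of "y + s *\<^sub>R u"]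
  show ?thesis
    unfolding orthogonal_projection_def
    by (rule the1_equality[OF ex1]) (use assms in \<open>auto simp: orthogonal_def inner_diff_right\<close>)
qed

text \<open>Each point of \<open>H\<close> near the foot of the perpendicular from \<open>c\<close>
  lies on a normal line of \<open>H\<close> that meets \<open>cball c r\<close>. That line meets
  \<open>K\<close>, and the meeting point projects back to the given point.\<close>

lemma interior_projection_blocking_set:
  fixes K :: "'a::euclidean_space set"
  assumes K: "blocks K (cball c r \<times> sphere 0 1)" and r: "r > 0" and H: "is_hyperplane H"
  shows "top_of_set H interior_of (orthogonal_projection H ` K) \<noteq> {}"
proof -
  have "affine hull H = H" using H by (simp add: is_hyperplane_def hull_same)
  then obtain u b where u: "u \<noteq> 0" "H = {x. u \<bullet> x = b}"
    using H aff_dim_eq_hyperplane[of H] \<open>affine hull H = H\<close>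
    by (auto simp: is_hyperplane_def of_nat_diff)
  \<comment> \<open>\<open>k\<close> is chosen so that \<open>p\<close> is the foot of the
    perpendicular from \<open>c\<close> to \<open>H\<close>.\<close>
  define k where "k = (u \<bullet> c - b) / (u \<bullet> u)"
  define p where "p = c - k *\<^sub>R u"
  have p: "p \<in> H" using u by (simp add: p_def k_def inner_diff_right)
  have "H \<inter> ball p r \<subseteq> orthogonal_projection H ` K"
  proof
    fix y assume y: "y \<in> H \<inter> ball p r"
    let ?v = "u /\<^sub>R norm u"
    have "(c + (y - p), ?v) \<in> cball c r \<times> sphere 0 1"
      using y u by (auto simp: dist_norm norm_minus_commute)
    then obtain s where s: "c + (y - p) + s *\<^sub>R ?v \<in> K" using blocksD[OF K] by blast
    have "c + (y - p) + s *\<^sub>R ?v = y + (k + s / norm u) *\<^sub>R u"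
      by (simp add: p_def algebra_simps divide_inverse)
    then have "orthogonal_projection H (c + (y - p) + s *\<^sub>R ?v) = y"
      using orthogonal_projection_hyperplane[OF u(2), of y "k + s / norm u"] y by (simp only: Int_iff)
    then show "y \<in> orthogonal_projection H ` K" using s by (metis imageI)
  qed
  moreover have "openin (top_of_set H) (H \<inter> ball p r)" by (simp add: openin_open_Int)
  ultimately have "H \<inter> ball p r \<subseteq> top_of_set H interior_of (orthogonal_projection H ` K)"
    by (rule interior_of_maximal)
  moreover have "p \<in> H \<inter> ball p r" using p r by simp
  ultimately show ?thesis by blast
qed

theorem theorem5p1:
  assumes "CARD('n::finite) \<ge> 2"
  shows "\<exists>K :: (real ^ 'n) set.
           compact K \<and>
           K \<subseteq> {x. \<forall>i. 0 \<le> x $ i \<and> x $ i \<le> 1} \<and>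
           (\<forall>H. is_hyperplane H \<longrightarrow>
              (top_of_set H) interior_of (orthogonal_projection H ` K) \<noteq> {}) \<and>
           nowhere_dense (K + K)"
proof -
  define c :: "real ^ 'n" where "c = (\<chi> i. 1/2)"
  \<comment> \<open>Unit directions keep the family of lines compact and the direction away from
    \<open>0\<close>, while still reaching every normal direction.\<close>
  let ?Z = "cball c (1/4) \<times> sphere (0 :: real ^ 'n) 1"
  have cube: "cball c (1/2) \<subseteq> {x. \<forall>i. 0 \<le> x $ i \<and> x $ i \<le> 1}"
  proof (clarify, intro conjI)
    fix x i assume "x \<in> cball c (1/2)"
    then have "\<bar>(c - x) $ i\<bar> \<le> 1/2"
      using component_le_norm_cart[of "c - x" i] by (simp add: dist_norm)
    then show "0 \<le> x $ i" "x $ i \<le> 1" by (simp_all add: c_def abs_if split: if_splits)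
  qed
  \<comment> \<open>Every base point is already interior to the larger ball, so parameter
    \<open>0\<close> works.\<close>
  have "blocks (interior (cball c (1/2))) ?Z"
    unfolding blocks_def by (auto intro!: exI[of _ 0])
  moreover have "compact ?Z" by (intro compact_Times compact_cball compact_sphere)
  moreover have "0 \<notin> snd ` ?Z" by auto
  ultimately obtain K where K: "compact K" "K \<subseteq> cball c (1/2)" "blocks K ?Z" "nowhere_dense (K + K)"
    using ex_blocking_set_nowhere_dense_sumset[of ?Z "cball c (1/2)"] compact_cball by blast
  have "(top_of_set H) interior_of (orthogonal_projection H ` K) \<noteq> {}" if "is_hyperplane H" for H
    using interior_projection_blocking_set[OF K(3) _ that] by simp
  then show ?thesis using K cube by (intro exI[of _ K]) blast
qed

end
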